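(* Let $L>0$ and $\sigma\ge0$. Let $\mathcal D\subset\mathbb R^d$ be an open set and assume that $|\nabla f(x)|^2\ge2Lf(x)$ for all $x\in\mathcal D$. Moreover, for $n\in\mathbb N_0$, let $\mathbb A_n=\{X_i\in\mathcal D\text{ for all }i=0,\dots,n\}$ and assume that $\mathbb E[|D_{n+1}|^2\mid\mathcal F_n]\le\sigma f(X_n)$ on $\mathbb A_n$. Let $y\in\mathcal D$ with $f(y)=0$. There exists $\bar\gamma>0$ such that if $\sup_{n\in\mathbb N}\gamma_n\le\bar\gamma$, then for every $\varepsilon>0$ there exists an $r_0>0$ such that if $X_0\in B_{r_0}(y)$, almost surely, and $\mathbb E[|V_0|^2]\le r_0$ we have $$\mathbb P(\mathbb A_\infty^c)\le\varepsilon,\qquad\text{where }\mathbb A_\infty=\bigcap_{n\in\mathbb N_0}\mathbb A_n.$$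
   Context: Setting. $f:\mathbb R^d\to\mathbb R$ is differentiable with $C_L$-Lipschitz continuous gradient for some constant $C_L\ge0$, and $\inf_{x\in\mathbb R^d}f(x)=0$. On a filtered probability space $(\Omega,(\mathcal F_n)_{n\in\mathbb N_0},\mathcal F,\mathbb P)$, $(X_n)_{n\in\mathbb N_0}$ and $(V_n)_{n\in\mathbb N_0}$ are $(\mathcal F_n)$-adapted $\mathbb R^d$-valued processes (momentum stochastic gradient descent, MSGD) satisfying, for all $n\in\mathbb N_0$, $$X_{n+1}=X_n+\gamma_{n+1}V_{n+1},\qquad V_{n+1}=V_n-\gamma_{n+1}\mu V_n-\gamma_{n+1}\nabla f(X_n)+\gamma_{n+1}D_{n+1},$$ where $X_0,V_0\in L^2(\Omega,\mathcal F_0)$, $(\gamma_n)_{n\in\mathbb N}$ is a sequence of strictly positive reals (step-sizes), $\mu>0$ (friction parameter), and $(D_n)_{n\in\mathbb N}$ is a sequence of $L^2$-martingale differences with respect to $(\mathcal F_n)_{n\in\mathbb N_0}$. $B_r(y)$ is the Euclidean ball of radius $r$ around $y$. *)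

theory Defs
  imports "HOL-Probability.Probability"
begin

definition filtered_prob_space :: "'w measure \<Rightarrow> (nat \<Rightarrow> 'w measure) \<Rightarrow> bool" where
  "filtered_prob_space M F \<longleftrightarrow>
     prob_space M \<and> filtration (space M) F \<and> (\<forall>n. subalgebra M (F n))"

text \<open>The library's conditional expectation is real-valued; for random vectors it is taken
  componentwise.\<close>

definition vec_cond_exp ::
  "'w measure \<Rightarrow> 'w measure \<Rightarrow> ('w \<Rightarrow> real ^ 'd) \<Rightarrow> 'w \<Rightarrow> real ^ 'd" where
  "vec_cond_exp M G Z w = (\<chi> i. real_cond_exp M G (\<lambda>v. Z v $ i) w)"

text \<open>The sequence is indexed by the positive integers, so the value \<open>D 0\<close> is irrelevant.\<close>

definition L2_martingale_differences ::
  "'w measure \<Rightarrow> (nat \<Rightarrow> 'w measure) \<Rightarrow> (nat \<Rightarrow> 'w \<Rightarrow> real ^ 'd) \<Rightarrow> bool" where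
  "L2_martingale_differences M F D \<longleftrightarrow>
     (\<forall>n. D (Suc n) \<in> borel_measurable (F (Suc n)) \<and>
          integrable M (\<lambda>w. (norm (D (Suc n) w))\<^sup>2) \<and>
          (AE w in M. vec_cond_exp M (F n) (D (Suc n)) w = 0))"

text \<open>Momentum stochastic gradient descent with gradient field \<open>g\<close>, friction \<open>\<mu>\<close>, step sizes
  \<open>\<gamma>\<close> (indexed by the positive integers) and perturbations \<open>D\<close>.\<close>

definition msgd ::
  "'w measure \<Rightarrow> (nat \<Rightarrow> 'w measure) \<Rightarrow> (real ^ 'd \<Rightarrow> real ^ 'd) \<Rightarrow> real \<Rightarrow> (nat \<Rightarrow> real) \<Rightarrow>
   (nat \<Rightarrow> 'w \<Rightarrow> real ^ 'd) \<Rightarrow> (nat \<Rightarrow> 'w \<Rightarrow> real ^ 'd) \<Rightarrow> (nat \<Rightarrow> 'w \<Rightarrow> real ^ 'd) \<Rightarrow> bool" where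
  "msgd M F g \<mu> \<gamma> D X V \<longleftrightarrow>
     filtered_prob_space M F \<and>
     L2_martingale_differences M F D \<and>
     (\<forall>n. X n \<in> borel_measurable (F n) \<and> V n \<in> borel_measurable (F n)) \<and>
     integrable M (\<lambda>w. (norm (X 0 w))\<^sup>2) \<and> integrable M (\<lambda>w. (norm (V 0 w))\<^sup>2) \<and>
     (\<forall>n. \<forall>w\<in>space M.
        X (Suc n) w = X n w + \<gamma> (Suc n) *\<^sub>R V (Suc n) w \<and>
        V (Suc n) w = V n w - (\<gamma> (Suc n) * \<mu>) *\<^sub>R V n w
                      - \<gamma> (Suc n) *\<^sub>R g (X n w) + \<gamma> (Suc n) *\<^sub>R D (Suc n) w)"

definition stay_event ::
  "'w measure \<Rightarrow> (nat \<Rightarrow> 'w \<Rightarrow> 'x) \<Rightarrow> 'x set \<Rightarrow> nat \<Rightarrow> 'w set" where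
  "stay_event M X S n = {w \<in> space M. \<forall>i\<le>n. X i w \<in> S}"

end

theory Submission imports Defs begin

text \<open>For large constants \<open>a\<close>, \<open>b\<close> the function \<open>E = a f(x) + \<nabla>f(x) \<bullet> v + b |v|\<^sup>2\<close> is comparable to
  \<open>f(x) + |v|\<^sup>2\<close>, and on the event \<open>A\<^sub>n\<close> it contracts in conditional mean by a factor
  \<open>1 - \<lambda> \<gamma>\<^sub>n\<^sub>+\<^sub>1\<close> in step \<open>n + 1\<close>, uniformly over small step sizes: the gradient domination absorbs
  both \<open>f\<close> and the noise variance \<open>\<sigma> f\<close>. Hence \<open>q\<^sub>n = (\<bbbE>[E\<^sub>n; A\<^sub>n])\<^sup>1\<^sup>/\<^sup>2\<close> satisfies
  \<open>\<gamma>\<^sub>n\<^sub>+\<^sub>1 q\<^sub>n \<le> (2/\<lambda>) (q\<^sub>n - q\<^sub>n\<^sub>+\<^sub>1)\<close>, so the expected length of the path up to the exit from \<open>S\<close>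
  telescopes to \<open>O(q\<^sub>0)\<close>, for any step sizes, summable or not. Since leaving \<open>S\<close> requires a path of
  length bounded below, Markov's inequality finishes the proof.\<close>

section \<open>Elementary inequalities and square-integrable random vectors\<close>

lemma two_inner_le:
  fixes u v :: "'a::real_inner"
  shows "2 * \<bar>u \<bullet> v\<bar> \<le> (norm u)\<^sup>2 + (norm v)\<^sup>2"
proof -
  have "\<bar>u \<bullet> v\<bar> \<le> norm u * norm v" by (rule Cauchy_Schwarz_ineq2)
  moreover have "2 * (norm u * norm v) \<le> (norm u)\<^sup>2 + (norm v)\<^sup>2"
    using sum_squares_bound[of "norm u" "norm v"] by (simp add: mult_ac)
  ultimately show ?thesis by linarith
qed

lemma norm_add_sq_le:
  fixes u v :: "'a::real_inner"
  shows "(norm (u + v))\<^sup>2 \<le> 2 * (norm u)\<^sup>2 + 2 * (norm v)\<^sup>2"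
  using two_inner_le[of u v] by (simp add: power2_norm_eq_inner inner_add inner_commute)

definition square_integrable :: "'w measure \<Rightarrow> ('w \<Rightarrow> 'a::euclidean_space) \<Rightarrow> bool" where
  "square_integrable M Z \<longleftrightarrow> Z \<in> borel_measurable M \<and> integrable M (\<lambda>w. (norm (Z w))\<^sup>2)"

lemma square_integrable_bound:
  assumes "Z \<in> borel_measurable M" "integrable M h" "\<And>w. w \<in> space M \<Longrightarrow> (norm (Z w))\<^sup>2 \<le> h w"
  shows "square_integrable M Z"
  unfolding square_integrable_def using assms
  by (intro conjI Bochner_Integration.integrable_bound[OF assms(2)]) (auto intro!: AE_I2 intro: order.trans[OF _ abs_ge_self])

lemma square_integrable_add:
  assumes "square_integrable M Y" "square_integrable M Z"
  shows "square_integrable M (\<lambda>w. Y w + Z w)"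
proof (rule square_integrable_bound)
  show "integrable M (\<lambda>w. 2 * (norm (Y w))\<^sup>2 + 2 * (norm (Z w))\<^sup>2)"
    using assms by (auto simp: square_integrable_def)
qed (use assms in \<open>auto simp: square_integrable_def norm_add_sq_le\<close>)

lemma square_integrable_scaleR:
  assumes "square_integrable M Z" shows "square_integrable M (\<lambda>w. c *\<^sub>R Z w)"
  using assms by (auto simp: square_integrable_def power_mult_distrib)

lemma square_integrable_diff:
  assumes "square_integrable M Y" "square_integrable M Z"
  shows "square_integrable M (\<lambda>w. Y w - Z w)"
  using square_integrable_add[OF assms(1) square_integrable_scaleR[OF assms(2), of "-1"]] by simp

lemma square_integrable_indicator:
  assumes "square_integrable M Z" "A \<in> sets M"
  shows "square_integrable M (\<lambda>w. indicator A w *\<^sub>R Z w)"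
proof (rule square_integrable_bound)
  show "integrable M (\<lambda>w. (norm (Z w))\<^sup>2)" using assms by (auto simp: square_integrable_def)
qed (use assms in \<open>auto simp: square_integrable_def indicator_def\<close>)

lemma square_integrable_norm_cong:
  assumes "square_integrable M Z" "Y \<in> borel_measurable M" "\<And>w. norm (Y w) \<le> norm (Z w)"
  shows "square_integrable M Y"
  using assms by (intro square_integrable_bound[of Y M "\<lambda>w. (norm (Z w))\<^sup>2"])
    (auto simp: square_integrable_def power_mono)

lemma integrable_inner:
  assumes "square_integrable M Y" "square_integrable M Z"
  shows "integrable M (\<lambda>w. Y w \<bullet> Z w)"
proof (rule Bochner_Integration.integrable_bound)
  show "integrable M (\<lambda>w. (norm (Y w))\<^sup>2 + (norm (Z w))\<^sup>2)"
    using assms by (auto simp: square_integrable_def)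
  show "AE w in M. norm (Y w \<bullet> Z w) \<le> norm ((norm (Y w))\<^sup>2 + (norm (Z w))\<^sup>2)"
  proof (rule AE_I2)
    fix w
    show "norm (Y w \<bullet> Z w) \<le> norm ((norm (Y w))\<^sup>2 + (norm (Z w))\<^sup>2)"
      using two_inner_le[of "Y w" "Z w"] by (simp add: abs_of_nonneg add_nonneg_nonneg)
  qed
qed (use assms in \<open>auto simp: square_integrable_def\<close>)

text \<open>A \<open>G\<close>-measurable factor passes through the conditional expectation under
  the integral. This is applied in each coordinate because \<open>vec_cond_exp\<close> is
  componentwise; square integrability of both factors makes the products integrable.\<close>

lemma integral_inner_martingale_difference:
  fixes P Z :: "'w \<Rightarrow> real ^ 'd"
  assumes "sigma_finite_subalgebra M G" and P: "P \<in> borel_measurable G"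
    and "square_integrable M P" "square_integrable M Z"
    and zero: "AE w in M. vec_cond_exp M G Z w = 0"
  shows "(\<integral>w. P w \<bullet> Z w \<partial>M) = 0"
proof -
  interpret sigma_finite_subalgebra M G by fact
  have coord: "(\<lambda>x. x $ i) \<in> borel_measurable borel" for i :: 'd
    by (intro borel_measurable_continuous_onI continuous_intros)
  have comp: "square_integrable M (\<lambda>w. U w $ i)" if "square_integrable M U" for U :: "'w \<Rightarrow> real ^ 'd" and i
    using that component_le_norm_cart[of _ i]
    by (intro square_integrable_norm_cong[OF that]
        measurable_compose[OF _ coord]) (auto simp: square_integrable_def)
  have int: "integrable M (\<lambda>w. P w $ i * Z w $ i)" for i
    using integrable_inner[OF comp[OF assms(3)] comp[OF assms(4)], of i i] by simp
  have "(\<integral>w. P w $ i * Z w $ i \<partial>M) = 0" for i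
  proof -
    have "(\<integral>w. P w $ i * Z w $ i \<partial>M) = (\<integral>w. P w $ i * real_cond_exp M G (\<lambda>v. Z v $ i) w \<partial>M)"
      using comp[OF assms(4)] measurable_compose[OF P coord] int
      by (intro real_cond_exp_intg(2)[symmetric]) (auto simp: square_integrable_def)
    also have "\<dots> = (\<integral>w. 0 \<partial>M)"
    proof (rule integral_cong_AE)
      show "(\<lambda>w. P w $ i * real_cond_exp M G (\<lambda>v. Z v $ i) w) \<in> borel_measurable M"
        using comp[OF assms(3), of i]
        by (intro borel_measurable_times borel_measurable_cond_exp2) (simp add: square_integrable_def)
      show "AE w in M. P w $ i * real_cond_exp M G (\<lambda>v. Z v $ i) w = 0"
        using zero by eventually_elim (auto simp: vec_cond_exp_def vec_eq_iff)
    qed simp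
    finally show ?thesis by simp
  qed
  then show ?thesis
    using int by (simp add: inner_vec_def Bochner_Integration.integral_sum)
qed

section \<open>Smooth functions and the Lyapunov function: deterministic estimates\<close>

locale momentum_descent =
  fixes f :: "'a::euclidean_space \<Rightarrow> real" and g :: "'a \<Rightarrow> 'a" and C \<mu> L \<sigma> :: real
  assumes gradient: "\<And>x. GDERIV f x :> g x"
    and lipschitz: "\<And>x y. norm (g x - g y) \<le> C * norm (x - y)"
    and f_nonneg: "\<And>x. 0 \<le> f x"
    and C_pos: "0 < C" and \<mu>_pos: "0 < \<mu>" and L_pos: "0 < L" and \<sigma>_nonneg: "0 \<le> \<sigma>"
begin

text \<open>The mean value theorem along the segment, with the Lipschitz bound applied at the
  intermediate point. This gives the constant \<open>C\<close> in place of the sharp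
  \<open>C / 2\<close>, which is enough here.\<close>

lemma descent: "f (x + h) \<le> f x + g x \<bullet> h + C * (norm h)\<^sup>2"
proof -
  have d: "((\<lambda>t. f (x + t *\<^sub>R h)) has_derivative (\<lambda>s. (s *\<^sub>R h) \<bullet> g (x + t *\<^sub>R h)))
      (at t within {0..1})" for t
    by (rule has_derivative_compose[where g = f])
       (use gradient in \<open>auto simp: gderiv_def intro!: derivative_eq_intros\<close>)
  then obtain t where t: "t \<in> {0..1}" "f (x + 1 *\<^sub>R h) - f (x + 0 *\<^sub>R h) = ((1 - 0) *\<^sub>R h) \<bullet> g (x + t *\<^sub>R h)"
    using mvt_very_simple[of 0 1 "\<lambda>t. f (x + t *\<^sub>R h)" "\<lambda>t s. (s *\<^sub>R h) \<bullet> g (x + t *\<^sub>R h)"] by auto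
  have "f (x + h) - f x - g x \<bullet> h = h \<bullet> (g (x + t *\<^sub>R h) - g x)"
    using t by (simp add: inner_diff_right inner_commute)
  also have "\<dots> \<le> norm h * norm (g (x + t *\<^sub>R h) - g x)"
    by (rule norm_cauchy_schwarz)
  also have "\<dots> \<le> norm h * (C * norm (t *\<^sub>R h))"
    using lipschitz[of "x + t *\<^sub>R h" x] by (intro mult_left_mono) auto
  also have "\<dots> \<le> norm h * (C * norm h)"
    using t C_pos by (intro mult_left_mono) (auto simp: mult_left_le_one_le)
  finally show ?thesis by (simp add: power2_eq_square algebra_simps)
qed

text \<open>After a gradient step of size \<open>1 / (2 * C)\<close>, which minimises the bound from
  \<open>descent\<close>, the value of \<open>f\<close> is still nonnegative.\<close>

lemma norm_gradient_le: "(norm (g x))\<^sup>2 \<le> 4 * C * f x"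
proof -
  define t where "t = 1 / (2 * C)"
  have "0 \<le> f (x + (- t) *\<^sub>R g x)" by (rule f_nonneg)
  also have "\<dots> \<le> f x - t * (norm (g x))\<^sup>2 + C * t\<^sup>2 * (norm (g x))\<^sup>2"
    using descent[of x "(- t) *\<^sub>R g x"] by (simp add: power_mult_distrib dot_square_norm)
  finally show ?thesis using C_pos by (simp add: t_def field_simps power2_eq_square)
qed

text \<open>The gradient vanishes at a zero of \<open>f\<close> by \<open>norm_gradient_le\<close>,
  so the expansion at \<open>y\<close> is purely quadratic. This turns closeness of the starting
  point to \<open>y\<close> into small initial energy.\<close>

lemma f_le_at_zero:
  assumes "f y = 0" shows "f x \<le> C * (norm (x - y))\<^sup>2"
proof -
  have "g y = 0" using norm_gradient_le[of y] assms by simp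
  then show ?thesis using descent[of y "x - y"] assms by simp
qed

text \<open>\<open>f_weight\<close> cancels the terms \<open>g x \<bullet> v\<close> of first order in the step size, \<open>v_weight\<close> makes
  the remaining ones at most \<open>-(|g x|\<^sup>2 + |v|\<^sup>2)\<close>, and \<open>quad_const\<close> bounds all terms of higher order.\<close>

definition "v_weight = 2 * C + 1 + (C + 1) / \<mu>"
definition "f_weight = 2 * v_weight + \<mu>"
definition "lyapunov x v = f_weight * f x + g x \<bullet> v + v_weight * (norm v)\<^sup>2"
definition "upper_const = f_weight + 1 + 2 * v_weight"
text \<open>Under gradient domination, half of \<open>(norm v)^2 + (norm (g x))^2\<close> is at
  least \<open>min 1 (2 * L) / 2\<close> times \<open>f x + (norm v)^2\<close>; dividing by
  \<open>upper_const\<close> expresses this through \<open>lyapunov\<close>.\<close>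

definition "rate = min 1 (2 * L) / (2 * upper_const)"
text \<open>The total coefficient of the squared new velocity after one step: the summands stem from
  the descent bound for \<open>f\<close>, the change of the gradient in the cross term, and the
  kinetic term.\<close>

definition "noise_const \<gamma> = f_weight * C * \<gamma>\<^sup>2 + C * \<gamma> + v_weight"
definition "quad_const =
  f_weight * (3 + 2 * \<mu>\<^sup>2) + v_weight * (2 + 2 * \<mu>\<^sup>2) + f_weight * C * (6 + 4 * \<mu>\<^sup>2)
  + 2 * C * (3 + 2 * \<mu>\<^sup>2) + C * (2 + 2 * \<mu>\<^sup>2)
  + \<sigma> * (f_weight * C + C + v_weight) / (2 * L)"
text \<open>The bound 1 allows higher powers of \<gamma> to be dropped; the other bound keeps the
  second-order remainder below half of the first-order dissipation.\<close>

definition "step_bound = min 1 (1 / (2 * quad_const))"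

lemma v_weight: "1 \<le> v_weight" "2 * C \<le> v_weight" "C + 1 \<le> 2 * v_weight * \<mu>"
proof -
  have 0: "0 \<le> (C + 1) / \<mu>" using C_pos \<mu>_pos by simp
  then show "1 \<le> v_weight" "2 * C \<le> v_weight"
    using C_pos by (auto simp: v_weight_def)
  have "v_weight * \<mu> = (2 * C + 1) * \<mu> + (C + 1)"
    using \<mu>_pos by (simp add: v_weight_def field_simps)
  moreover have "0 \<le> (2 * C + 1) * \<mu>" using C_pos \<mu>_pos by simp
  ultimately show "C + 1 \<le> 2 * v_weight * \<mu>" using C_pos by linarith
qed

lemma f_weight: "2 * v_weight \<le> f_weight" "2 \<le> f_weight"
  using v_weight \<mu>_pos by (auto simp: f_weight_def)

lemma upper_const_pos: "0 < upper_const"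
  using v_weight f_weight by (auto simp: upper_const_def)

lemma rate_pos: "0 < rate"
  using upper_const_pos L_pos by (auto simp: rate_def)

lemma noise_const_nonneg: "0 \<le> \<gamma> \<Longrightarrow> 0 \<le> noise_const \<gamma>"
  using v_weight f_weight C_pos by (auto simp: noise_const_def)

lemma quad_const_pos: "0 < quad_const"
proof -
  have "0 < f_weight" "0 < v_weight" using v_weight f_weight by auto
  then show ?thesis
    unfolding quad_const_def using C_pos L_pos \<sigma>_nonneg
    by (intro add_pos_nonneg mult_nonneg_nonneg divide_nonneg_nonneg mult_pos_pos add_nonneg_nonneg
        add_pos_nonneg) auto
qed

lemma step_bound_pos: "0 < step_bound"
  using quad_const_pos by (simp add: step_bound_def)

text \<open>Completing the square in \<open>g x + v_weight *\<^sub>R v\<close> shows that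
  \<open>2 * f x\<close> and half of the kinetic term pay for the cross term, since
  \<open>norm_gradient_le\<close> controls the squared gradient by \<open>f\<close>.\<close>

lemma lyapunov_lower: "f x + (norm v)\<^sup>2 \<le> 2 * lyapunov x v"
proof -
  have b: "0 < v_weight" using v_weight by simp
  have "0 \<le> (norm (g x + v_weight *\<^sub>R v))\<^sup>2 / v_weight" using b by simp
  also have "\<dots> = (norm (g x))\<^sup>2 / v_weight + 2 * (g x \<bullet> v) + v_weight * (norm v)\<^sup>2"
    using b by (simp add: power2_norm_eq_inner inner_add inner_commute field_simps)
  finally have 1: "0 \<le> (norm (g x))\<^sup>2 / v_weight + 2 * (g x \<bullet> v) + v_weight * (norm v)\<^sup>2" .
  have "(norm (g x))\<^sup>2 \<le> (2 * v_weight) * f x"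
    using norm_gradient_le[of x] mult_right_mono[OF v_weight(2) f_nonneg[of x]] by linarith
  then have 2: "(norm (g x))\<^sup>2 / v_weight \<le> 2 * f x"
    using b by (simp add: field_simps)
  have "4 * f x \<le> 2 * f_weight * f x"
    using mult_right_mono[OF f_weight(2) f_nonneg[of x]] by linarith
  moreover have "(norm v)\<^sup>2 \<le> v_weight * (norm v)\<^sup>2"
    using mult_right_mono[OF v_weight(1), of "(norm v)\<^sup>2"] by simp
  ultimately show ?thesis
    using 1 2 f_nonneg[of x] unfolding lyapunov_def by (simp add: algebra_simps)
qed

lemma lyapunov_nonneg: "0 \<le> lyapunov x v"
  using lyapunov_lower[of x v] f_nonneg[of x] by (smt (verit) zero_le_power2)

lemma lyapunov_upper: "lyapunov x v \<le> upper_const * (f x + (norm v)\<^sup>2)"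
proof -
  have "2 * \<bar>g x \<bullet> v\<bar> \<le> (norm (g x))\<^sup>2 + (norm v)\<^sup>2" by (rule two_inner_le)
  moreover have "(norm (g x))\<^sup>2 \<le> (2 * v_weight) * f x"
    using norm_gradient_le[of x] mult_right_mono[OF v_weight(2) f_nonneg[of x]] by linarith
  moreover have "0 \<le> v_weight * f x" "0 \<le> v_weight * (norm v)\<^sup>2" "0 \<le> f_weight * (norm v)\<^sup>2"
    using v_weight f_weight f_nonneg[of x] by auto
  ultimately show ?thesis
    using f_nonneg[of x] zero_le_power2[of "norm v"]
    unfolding lyapunov_def upper_const_def by (simp add: algebra_simps)
qed

text \<open>Here \<open>w\<close> is the new velocity without noise, and the last summand on the
  left accounts for the noise variance. In the expansion in \<gamma>, the first-order part is at
  most \<open>- \<gamma> * G\<close>, the remainder costs at most half of that, and the other half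
  dominates \<open>rate * \<gamma>\<close> times the energy.\<close>

lemma drift_bound:
  fixes x v :: 'a
  assumes "0 < \<gamma>" "\<gamma> \<le> step_bound" "2 * L * f x \<le> (norm (g x))\<^sup>2"
  defines "w \<equiv> v - (\<gamma> * \<mu>) *\<^sub>R v - \<gamma> *\<^sub>R g x"
  shows "f_weight * f x + (f_weight * \<gamma> + 1) * (g x \<bullet> w) + noise_const \<gamma> * (norm w)\<^sup>2
      + noise_const \<gamma> * \<gamma>\<^sup>2 * \<sigma> * f x \<le> (1 - rate * \<gamma>) * lyapunov x v"
proof -
  let ?a = f_weight and ?b = v_weight
  \<comment> \<open>\<open>w = v - \<gamma> *\<^sub>R u\<close>; every term is compared with the
    dissipation \<open>G\<close>, and \<open>m\<close> is the constant in
    \<open>(norm u)^2 \<le> m * G\<close>.\<close>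
  define u where "u = \<mu> *\<^sub>R v + g x"
  define G where "G = (norm v)\<^sup>2 + (norm (g x))\<^sup>2"
  define m where "m = 2 + 2 * \<mu>\<^sup>2"
  have w: "w = v - \<gamma> *\<^sub>R u" by (simp add: w_def u_def algebra_simps)
  have \<gamma>1: "\<gamma> \<le> 1" and \<gamma>q: "\<gamma> * quad_const \<le> 1 / 2"
    using assms(2) quad_const_pos by (auto simp: step_bound_def field_simps)
  have pos: "0 < ?a" "0 < ?b" "0 \<le> m" "0 \<le> G" using f_weight v_weight by (auto simp: m_def G_def)
  have vG: "(norm v)\<^sup>2 \<le> G" and gG: "(norm (g x))\<^sup>2 \<le> G" by (auto simp: G_def)
  have "(norm u)\<^sup>2 \<le> 2 * (\<mu>\<^sup>2 * (norm v)\<^sup>2) + 2 * (norm (g x))\<^sup>2"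
    unfolding u_def using norm_add_sq_le[of "\<mu> *\<^sub>R v" "g x"] by (simp add: power_mult_distrib)
  also have "\<dots> \<le> m * G" by (simp add: m_def G_def algebra_simps)
  finally have uG: "(norm u)\<^sup>2 \<le> m * G" .
  have gu: "\<bar>g x \<bullet> u\<bar> \<le> (1 + m) * G" and vu: "\<bar>v \<bullet> u\<bar> \<le> (1 + m) * G"
    using two_inner_le[of "g x" u] two_inner_le[of v u] uG vG gG pos
    by (auto simp: algebra_simps)
  have "\<gamma>\<^sup>2 \<le> 1" using \<gamma>1 assms(1) by (simp add: power_le_one)
  then have "\<gamma>\<^sup>2 * (norm u)\<^sup>2 \<le> (norm u)\<^sup>2" by (simp add: mult_left_le_one_le)
  then have "(norm w)\<^sup>2 \<le> 2 * G + 2 * m * G"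
    unfolding w using norm_add_sq_le[of v "- (\<gamma> *\<^sub>R u)"] vG uG by (simp add: power_mult_distrib)
  then have wG: "(norm w)\<^sup>2 \<le> (2 + 2 * m) * G" by (simp add: algebra_simps)
  \<comment> \<open>Gradient domination enters: a noise variance proportional to \<open>f x\<close>
    is also bounded by a multiple of \<open>G\<close>.\<close>
  have fG: "f x \<le> G / (2 * L)"
    using assms(3) gG L_pos by (simp add: field_simps)
  have w2: "(norm w)\<^sup>2 = (norm v)\<^sup>2 - 2 * \<gamma> * (v \<bullet> u) + \<gamma>\<^sup>2 * (norm u)\<^sup>2"
    unfolding w power2_norm_eq_inner by (simp add: inner_diff inner_commute power2_eq_square algebra_simps)
  have gw: "g x \<bullet> w = g x \<bullet> v - \<gamma> * (g x \<bullet> u)"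
    unfolding w by (simp add: inner_diff)
  \<comment> \<open>\<open>\<gamma>^2 * Q\<close> is everything beyond first order; \<open>Q\<close>
    itself still depends on \<gamma>. Its six summands are bounded by \<open>q1\<close> to
    \<open>q6\<close>, matching the summands of \<open>quad_const\<close> in order.\<close>
  define Q where "Q = - ?a * (g x \<bullet> u) + ?b * (norm u)\<^sup>2 + ?a * C * (norm w)\<^sup>2 - 2 * C * (v \<bullet> u)
      + C * \<gamma> * (norm u)\<^sup>2 + noise_const \<gamma> * \<sigma> * f x"
  have "noise_const \<gamma> \<le> ?a * C + C + ?b"
    unfolding noise_const_def using \<gamma>1 \<open>\<gamma>\<^sup>2 \<le> 1\<close> pos C_pos
    by (intro add_mono) (auto intro: mult_left_le)
  then have "noise_const \<gamma> * (\<sigma> * f x) \<le> (?a * C + C + ?b) * (\<sigma> * (G / (2 * L)))"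
    using fG f_nonneg[of x] \<sigma>_nonneg pos C_pos
    by (intro mult_mono mult_left_mono) (auto intro!: add_nonneg_nonneg)
  then have q6: "noise_const \<gamma> * \<sigma> * f x \<le> (\<sigma> * (?a * C + C + ?b) / (2 * L)) * G"
    by (simp add: mult_ac)
  have q1: "- ?a * (g x \<bullet> u) \<le> ?a * ((1 + m) * G)"
    using mult_left_mono[of "- (g x \<bullet> u)" "(1 + m) * G" ?a] gu pos by simp
  have q2: "?b * (norm u)\<^sup>2 \<le> ?b * (m * G)" using uG pos by simp
  have q3: "?a * C * (norm w)\<^sup>2 \<le> ?a * C * ((2 + 2 * m) * G)"
    using wG pos C_pos by (intro mult_left_mono) auto
  have q4: "- 2 * C * (v \<bullet> u) \<le> 2 * C * ((1 + m) * G)"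
    using mult_left_mono[of "- (v \<bullet> u)" "(1 + m) * G" "2 * C"] vu C_pos by simp
  have q5: "C * \<gamma> * (norm u)\<^sup>2 \<le> C * (m * G)"
    using mult_mono[of "\<gamma>" 1 "(norm u)\<^sup>2" "m * G"] uG \<gamma>1 assms(1) C_pos
    by (simp add: mult.assoc)
  have "Q \<le> quad_const * G"
    using q1 q2 q3 q4 q5 q6 unfolding Q_def quad_const_def m_def by (simp add: algebra_simps)
  then have "\<gamma>\<^sup>2 * Q \<le> \<gamma> * ((\<gamma> * quad_const) * G)"
    using mult_left_mono[of Q "quad_const * G" "\<gamma>\<^sup>2"] by (simp add: power2_eq_square mult_ac)
  also have "\<dots> \<le> \<gamma> * (1 / 2 * G)"
    using \<gamma>q pos assms(1) by (intro mult_left_mono mult_right_mono) auto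
  finally have second: "\<gamma>\<^sup>2 * Q \<le> \<gamma> * G / 2" by simp
  \<comment> \<open>The inner products of \<open>g x\<close> and \<open>v\<close> coming from the
    potential, cross and kinetic terms have coefficients \<open>f_weight\<close>,
    \<open>- \<mu>\<close> and \<open>- 2 * v_weight\<close>, which add up to zero.\<close>
  have "?a * (g x \<bullet> v) - g x \<bullet> u - 2 * ?b * (v \<bullet> u) + C * (norm v)\<^sup>2
     = (C - 2 * ?b * \<mu>) * (norm v)\<^sup>2 - (norm (g x))\<^sup>2"
    unfolding u_def f_weight_def power2_norm_eq_inner
    by (simp add: inner_add inner_commute algebra_simps)
  also have "\<dots> \<le> (- 1) * (norm v)\<^sup>2 - (norm (g x))\<^sup>2"
    using v_weight(3) by (intro diff_right_mono mult_right_mono) auto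
  finally have "?a * (g x \<bullet> v) - g x \<bullet> u - 2 * ?b * (v \<bullet> u) + C * (norm v)\<^sup>2 \<le> - G"
    by (simp add: G_def)
  then have first: "\<gamma> * (?a * (g x \<bullet> v) - g x \<bullet> u - 2 * ?b * (v \<bullet> u) + C * (norm v)\<^sup>2) \<le> - \<gamma> * G"
    using mult_left_mono[of _ "- G" \<gamma>] assms(1) by simp
  have eq: "?a * f x + (?a * \<gamma> + 1) * (g x \<bullet> w) + noise_const \<gamma> * (norm w)\<^sup>2
      + noise_const \<gamma> * \<gamma>\<^sup>2 * \<sigma> * f x
    = lyapunov x v + \<gamma> * (?a * (g x \<bullet> v) - g x \<bullet> u - 2 * ?b * (v \<bullet> u) + C * (norm v)\<^sup>2) + \<gamma>\<^sup>2 * Q"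
  proof -
    \<comment> \<open>Only the part of \<open>noise_const\<close> without a factor
      \<open>\<gamma>^2\<close> needs the expansion \<open>w2\<close>; the other part already
      belongs to \<open>Q\<close>.\<close>
    have "noise_const \<gamma> * (norm w)\<^sup>2 = ?a * C * \<gamma>\<^sup>2 * (norm w)\<^sup>2
       + (C * \<gamma> + ?b) * ((norm v)\<^sup>2 - 2 * \<gamma> * (v \<bullet> u) + \<gamma>\<^sup>2 * (norm u)\<^sup>2)"
      unfolding noise_const_def w2[symmetric] by (simp add: algebra_simps)
    then show ?thesis
      unfolding gw Q_def lyapunov_def by (simp add: algebra_simps power2_eq_square)
  qed
  have "rate * lyapunov x v \<le> rate * (upper_const * (f x + (norm v)\<^sup>2))"
    using rate_pos lyapunov_upper by (intro mult_left_mono) auto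
  also have "\<dots> = min 1 (2 * L) * (f x + (norm v)\<^sup>2) / 2"
    using upper_const_pos by (simp add: rate_def)
  also have "\<dots> \<le> G / 2"
  proof -
    have "min 1 (2 * L) * f x \<le> 2 * L * f x" "min 1 (2 * L) * (norm v)\<^sup>2 \<le> 1 * (norm v)\<^sup>2"
      using f_nonneg[of x] by (intro mult_right_mono; simp)+
    then show ?thesis using assms(3) by (simp add: G_def algebra_simps)
  qed
  finally have "rate * lyapunov x v \<le> G / 2" .
  then have "\<gamma> * (rate * lyapunov x v) \<le> \<gamma> * (G / 2)"
    using assms(1) by (intro mult_left_mono) auto
  then show ?thesis
    unfolding eq using first second by (simp add: algebra_simps)
qed

text \<open>A pathwise bound arranged for taking expectations: the terms linear in \<open>d\<close>
  have coefficients determined by \<open>x\<close> and \<open>v\<close>, and subtracting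
  \<open>\<sigma> * f x\<close> from the squared noise leaves a term of nonpositive conditional
  mean. The compensating variance is the one inside \<open>drift_bound\<close>.\<close>

lemma lyapunov_step:
  fixes x v x' v' d :: 'a
  assumes "0 < \<gamma>" "\<gamma> \<le> step_bound" "2 * L * f x \<le> (norm (g x))\<^sup>2"
    and v': "v' = v - (\<gamma> * \<mu>) *\<^sub>R v - \<gamma> *\<^sub>R g x + \<gamma> *\<^sub>R d"
    and x': "x' = x + \<gamma> *\<^sub>R v'"
  defines "w \<equiv> v - (\<gamma> * \<mu>) *\<^sub>R v - \<gamma> *\<^sub>R g x"
  shows "lyapunov x' v' \<le> (1 - rate * \<gamma>) * lyapunov x v
    + ((f_weight * \<gamma> + 1) * \<gamma>) * (g x \<bullet> d) + (2 * noise_const \<gamma> * \<gamma>) * (w \<bullet> d)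
    + noise_const \<gamma> * \<gamma>\<^sup>2 * ((norm d)\<^sup>2 - \<sigma> * f x)"
proof -
  have vw: "v' = w + \<gamma> *\<^sub>R d" by (simp add: v' w_def)
  have "f x' \<le> f x + \<gamma> * (g x \<bullet> v') + C * (\<gamma>\<^sup>2 * (norm v')\<^sup>2)"
    unfolding x' using descent[of x "\<gamma> *\<^sub>R v'"] by (simp add: power_mult_distrib)
  then have 1: "f_weight * f x' \<le> f_weight * (f x + \<gamma> * (g x \<bullet> v') + C * (\<gamma>\<^sup>2 * (norm v')\<^sup>2))"
    using f_weight by (intro mult_left_mono) auto
  \<comment> \<open>The gradient at \<open>x'\<close> depends on the noise \<open>d\<close>; it is
    traded for the gradient at \<open>x\<close> so that the coefficients of \<open>d\<close> are
    known before the step.\<close>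
  have "(g x' - g x) \<bullet> v' \<le> norm (g x' - g x) * norm v'" by (rule norm_cauchy_schwarz)
  also have "\<dots> \<le> (C * norm (x' - x)) * norm v'"
    by (intro mult_right_mono lipschitz) auto
  also have "\<dots> = C * \<gamma> * (norm v')\<^sup>2"
    using assms(1) by (simp add: x' power2_eq_square)
  finally have 2: "g x' \<bullet> v' \<le> g x \<bullet> v' + C * \<gamma> * (norm v')\<^sup>2"
    by (simp add: inner_diff)
  have n: "(norm v')\<^sup>2 = (norm w)\<^sup>2 + 2 * \<gamma> * (w \<bullet> d) + \<gamma>\<^sup>2 * (norm d)\<^sup>2"
    unfolding vw power2_norm_eq_inner by (simp add: inner_add inner_commute power2_eq_square algebra_simps)
  have "lyapunov x' v' \<le> f_weight * f x + (f_weight * \<gamma> + 1) * (g x \<bullet> v') + noise_const \<gamma> * (norm v')\<^sup>2"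
    using 1 2 unfolding lyapunov_def noise_const_def by (simp add: algebra_simps)
  also have "\<dots> = (f_weight * f x + (f_weight * \<gamma> + 1) * (g x \<bullet> w) + noise_const \<gamma> * (norm w)\<^sup>2
      + noise_const \<gamma> * \<gamma>\<^sup>2 * \<sigma> * f x)
    + ((f_weight * \<gamma> + 1) * \<gamma>) * (g x \<bullet> d) + (2 * noise_const \<gamma> * \<gamma>) * (w \<bullet> d)
    + noise_const \<gamma> * \<gamma>\<^sup>2 * ((norm d)\<^sup>2 - \<sigma> * f x)"
    unfolding n by (simp add: vw inner_add algebra_simps)
  finally show ?thesis
    using drift_bound[OF assms(1-3), of v] unfolding w_def by linarith
qed

end

section \<open>The process: measurability and integrability\<close>

locale momentum_process = momentum_descent f g C \<mu> L \<sigma>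
  for f :: "real ^ 'd \<Rightarrow> real" and g C \<mu> L \<sigma> +
  fixes M :: "'w measure" and F \<gamma> D X V and S :: "(real ^ 'd) set"
  assumes msgd: "msgd M F g \<mu> \<gamma> D X V"
    and open_S: "open S"
    and lojasiewicz: "\<And>x. x \<in> S \<Longrightarrow> 2 * L * f x \<le> (norm (g x))\<^sup>2"
    and \<gamma>_pos: "\<And>n. 0 < \<gamma> (Suc n)" and \<gamma>_le: "\<And>n. \<gamma> (Suc n) \<le> step_bound"
    and noise: "\<And>n. AE w in M. w \<in> stay_event M X S n \<longrightarrow>
      real_cond_exp M (F n) (\<lambda>v. (norm (D (Suc n) v))\<^sup>2) w \<le> \<sigma> * f (X n w)"
begin

abbreviation "A \<equiv> stay_event M X S"

lemma
  shows prob: "prob_space M" and filt: "filtration (space M) F" and sub: "subalgebra M (F n)"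
    and D_F: "D (Suc n) \<in> borel_measurable (F (Suc n))"
    and D_int: "integrable M (\<lambda>w. (norm (D (Suc n) w))\<^sup>2)"
    and D_zero: "AE w in M. vec_cond_exp M (F n) (D (Suc n)) w = 0"
    and X_F: "X n \<in> borel_measurable (F n)" and V_F: "V n \<in> borel_measurable (F n)"
    and X_Suc: "w \<in> space M \<Longrightarrow> X (Suc n) w = X n w + \<gamma> (Suc n) *\<^sub>R V (Suc n) w"
    and V_Suc: "w \<in> space M \<Longrightarrow> V (Suc n) w = V n w - (\<gamma> (Suc n) * \<mu>) *\<^sub>R V n w
      - \<gamma> (Suc n) *\<^sub>R g (X n w) + \<gamma> (Suc n) *\<^sub>R D (Suc n) w"
  using msgd unfolding msgd_def filtered_prob_space_def L2_martingale_differences_def by blast+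

sublocale prob_space M by (rule prob)

lemma sub_sf: "sigma_finite_subalgebra M (F n)"
  by (intro finite_measure_subalgebra_is_sigma_finite finite_measure_subalgebra.intro
      finite_measure_subalgebra_axioms.intro sub) unfold_locales

lemma X_M [measurable]: "X n \<in> borel_measurable M" and V_M [measurable]: "V n \<in> borel_measurable M"
  and D_M: "D (Suc n) \<in> borel_measurable M"
  using measurable_from_subalg[OF sub] X_F V_F D_F by blast+

lemma g_cont: "continuous_on UNIV g"
proof -
  have "C-lipschitz_on UNIV g"
    using C_pos lipschitz by (auto intro!: lipschitz_onI simp: dist_norm)
  then show ?thesis by (rule lipschitz_on_continuous_on)
qed

lemma g_borel [measurable]: "g \<in> borel_measurable borel"
  using g_cont by (rule borel_measurable_continuous_onI)

lemma f_borel [measurable]: "f \<in> borel_measurable borel"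
proof (rule borel_measurable_continuous_onI)
  show "continuous_on UNIV f"
    using gradient unfolding gderiv_def
    by (blast intro: continuous_at_imp_continuous_on has_derivative_continuous)
qed

text \<open>Adaptedness gives measurability at time \<open>n\<close>, not only in \<open>M\<close>;
  this lets the indicator of \<open>A n\<close> multiply the noise of step \<open>n + 1\<close>
  without destroying the martingale property.\<close>

lemma A_F: "A n \<in> sets (F n)"
proof -
  interpret filtration "space M" F by (rule filt)
  have "X i -` S \<inter> space M \<in> sets (F n)" if "i \<le> n" for i
    using measurable_sets[OF X_F, of S i] open_S sets_F_mono[OF that] space_F by auto
  then have "(\<Inter>i\<in>{..n}. X i -` S \<inter> space M) \<in> sets (F n)"
    by (intro sets.finite_INT) auto
  also have "(\<Inter>i\<in>{..n}. X i -` S \<inter> space M) = A n"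
    by (auto simp: stay_event_def)
  finally show ?thesis .
qed

lemma A_M [measurable]: "A n \<in> sets M"
  using A_F sub by (auto simp: subalgebra_def)

lemma A_Suc: "A (Suc n) \<subseteq> A n"
  by (auto simp: stay_event_def)

lemma A_in_S: "w \<in> A n \<Longrightarrow> X n w \<in> S"
  by (auto simp: stay_event_def)

lemma square_integrable_gradient:
  assumes "square_integrable M Z"
  shows "square_integrable M (\<lambda>w. g (Z w))"
proof (rule square_integrable_bound)
  have [measurable]: "Z \<in> borel_measurable M" using assms by (simp add: square_integrable_def)
  show "(\<lambda>w. g (Z w)) \<in> borel_measurable M" by measurable
  show "integrable M (\<lambda>w. 2 * (norm (g 0))\<^sup>2 + 2 * (C\<^sup>2 * (norm (Z w))\<^sup>2))"
    using assms by (simp add: square_integrable_def)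
  fix w
  have "(norm (g (Z w) - g 0))\<^sup>2 \<le> (C * norm (Z w))\<^sup>2"
    using lipschitz[of "Z w" 0] by (intro power_mono) auto
  then show "(norm (g (Z w)))\<^sup>2 \<le> 2 * (norm (g 0))\<^sup>2 + 2 * (C\<^sup>2 * (norm (Z w))\<^sup>2)"
    using norm_add_sq_le[of "g 0" "g (Z w) - g 0"] by (simp add: power_mult_distrib)
qed

lemma D_L2: "square_integrable M (D (Suc n))"
  using D_M D_int by (simp add: square_integrable_def)

lemma square_integrable_cong_space:
  "(\<And>w. w \<in> space M \<Longrightarrow> Y w = Z w) \<Longrightarrow> square_integrable M Z \<Longrightarrow> square_integrable M Y"
  unfolding square_integrable_def
  by (metis (no_types, lifting) Bochner_Integration.integrable_cong measurable_cong)

text \<open>Position and velocity need a joint induction: the new velocity uses the old position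
  through the gradient, which grows at most linearly, and the new position uses the new
  velocity.\<close>

lemma XV_L2: "square_integrable M (X n) \<and> square_integrable M (V n)"
proof (induction n)
  case 0
  then show ?case using msgd by (auto simp: square_integrable_def msgd_def X_M V_M)
next
  case (Suc n)
  have V: "square_integrable M (V (Suc n))"
    by (rule square_integrable_cong_space[OF V_Suc]) 
       (use Suc D_L2 in \<open>auto intro!: square_integrable_add square_integrable_diff square_integrable_scaleR
         square_integrable_gradient\<close>)
  have "square_integrable M (X (Suc n))"
    by (rule square_integrable_cong_space[OF X_Suc])
       (use Suc V in \<open>auto intro!: square_integrable_add square_integrable_scaleR\<close>)
  with V show ?case by simp
qed

lemmas X_L2 = XV_L2[THEN conjunct1] and V_L2 = XV_L2[THEN conjunct2]

lemma f_X_int: "integrable M (\<lambda>w. f (X n w))"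
proof (rule Bochner_Integration.integrable_bound)
  show "integrable M (\<lambda>w. f 0 + (norm (g 0))\<^sup>2 + (1 + C) * (norm (X n w))\<^sup>2)"
    using X_L2 by (simp add: square_integrable_def)
  show "AE w in M. norm (f (X n w)) \<le> norm (f 0 + (norm (g 0))\<^sup>2 + (1 + C) * (norm (X n w))\<^sup>2)"
  proof (rule AE_I2)
    fix w
    have "f (X n w) \<le> f 0 + (norm (g 0))\<^sup>2 + (1 + C) * (norm (X n w))\<^sup>2"
      using descent[of 0 "X n w"] two_inner_le[of "g 0" "X n w"] by (simp add: algebra_simps)
    then show "norm (f (X n w)) \<le> norm (f 0 + (norm (g 0))\<^sup>2 + (1 + C) * (norm (X n w))\<^sup>2)"
      using f_nonneg[of "X n w"] by simp
  qed
qed measurable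

lemma lyapunov_int: "integrable M (\<lambda>w. lyapunov (X n w) (V n w))"
  unfolding lyapunov_def
  using f_X_int integrable_inner[OF square_integrable_gradient[OF X_L2] V_L2] V_L2
  by (auto simp: square_integrable_def)

section \<open>Decay of the energy on the event of not having left \<open>S\<close>\<close>

lemma integrable_indicator_mult:
  "integrable M h \<Longrightarrow> B \<in> sets M \<Longrightarrow> integrable M (\<lambda>w. indicator B w * (h w :: real))"
  using integrable_mult_indicator[of B M h] by simp

text \<open>Restricting to \<open>A n\<close> plays the role of stopping at the exit time: gradient
  domination and the noise bound are available only there.\<close>

definition "energy n = (\<integral>w. indicator (A n) w * lyapunov (X n w) (V n w) \<partial>M)"

lemma noise_orthogonal:
  assumes "P \<in> borel_measurable (F n)" "square_integrable M P"
  shows "integrable M (\<lambda>w. indicator (A n) w * (P w \<bullet> D (Suc n) w))"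
    and "(\<integral>w. indicator (A n) w * (P w \<bullet> D (Suc n) w) \<partial>M) = 0"
proof -
  let ?P = "\<lambda>w. indicat_real (A n) w *\<^sub>R P w"
  have P: "square_integrable M ?P"
    using assms by (intro square_integrable_indicator) auto
  show "integrable M (\<lambda>w. indicator (A n) w * (P w \<bullet> D (Suc n) w))"
    using integrable_inner[OF P D_L2[of n]] by simp
  have "?P \<in> borel_measurable (F n)"
    using assms(1) A_F[of n] by (intro borel_measurable_scaleR) auto
  then show "(\<integral>w. indicator (A n) w * (P w \<bullet> D (Suc n) w) \<partial>M) = 0"
    using integral_inner_martingale_difference[OF sub_sf _ P D_L2 D_zero] by simp
qed

text \<open>As \<open>A n\<close> belongs to \<open>F n\<close>, the squared noise may be replaced
  by its conditional expectation under the integral, where the variance assumption applies.\<close>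

lemma noise_second_moment:
  "(\<integral>w. indicator (A n) w * ((norm (D (Suc n) w))\<^sup>2 - \<sigma> * f (X n w)) \<partial>M) \<le> 0"
proof -
  interpret sigma_finite_subalgebra M "F n" by (rule sub_sf)
  let ?N = "\<lambda>v. (norm (D (Suc n) v))\<^sup>2"
  have int: "integrable M (\<lambda>w. indicat_real (A n) w * ?N w)"
    by (intro integrable_indicator_mult D_int) auto
  have int2: "integrable M (\<lambda>w. indicat_real (A n) w * (\<sigma> * f (X n w)))"
    by (intro integrable_indicator_mult integrable_mult_right f_X_int) auto
  have ind: "indicat_real (A n) \<in> borel_measurable (F n)" using A_F by simp
  have N: "?N \<in> borel_measurable M" using D_M by measurable
  have "(\<integral>w. indicat_real (A n) w * ?N w \<partial>M) = (\<integral>w. indicat_real (A n) w * real_cond_exp M (F n) ?N w \<partial>M)"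
    by (rule real_cond_exp_intg(2)[OF int ind N, symmetric])
  also have "\<dots> \<le> (\<integral>w. indicat_real (A n) w * (\<sigma> * f (X n w)) \<partial>M)"
  proof (rule integral_mono_AE[OF real_cond_exp_intg(1)[OF int ind N] int2])
    show "AE w in M. indicat_real (A n) w * real_cond_exp M (F n) ?N w
      \<le> indicat_real (A n) w * (\<sigma> * f (X n w))"
      using noise[of n] by eventually_elim (auto simp: indicator_def)
  qed
  finally show ?thesis
    using int int2 by (simp add: right_diff_distrib)
qed

text \<open>\<open>lyapunov_step\<close> is integrated over \<open>A n\<close>: the two linear noise
  terms vanish and the quadratic one is nonpositive. Keeping \<open>A n\<close> on the left, instead
  of \<open>A (Suc n)\<close>, also controls the velocity of the step that leaves
  \<open>S\<close>.\<close>

lemma lyapunov_Suc_le: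
  "(\<integral>w. indicator (A n) w * lyapunov (X (Suc n) w) (V (Suc n) w) \<partial>M)
    \<le> (1 - rate * \<gamma> (Suc n)) * energy n"
proof -
  let ?\<gamma> = "\<gamma> (Suc n)" and ?I = "indicat_real (A n)"
  let ?W = "\<lambda>w. V n w - (?\<gamma> * \<mu>) *\<^sub>R V n w - ?\<gamma> *\<^sub>R g (X n w)"
  let ?c1 = "(f_weight * ?\<gamma> + 1) * ?\<gamma>" and ?c2 = "2 * noise_const ?\<gamma> * ?\<gamma>" and ?c3 = "noise_const ?\<gamma> * ?\<gamma>\<^sup>2"
  have gF: "(\<lambda>w. g (X n w)) \<in> borel_measurable (F n)" using X_F by measurable
  have g2: "square_integrable M (\<lambda>w. g (X n w))" by (rule square_integrable_gradient[OF X_L2])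
  have WF: "?W \<in> borel_measurable (F n)" using V_F[of n] gF by measurable
  have W2: "square_integrable M ?W"
    using V_L2 g2 by (intro square_integrable_diff square_integrable_scaleR) auto
  note i1 = noise_orthogonal[OF gF g2] and i2 = noise_orthogonal[OF WF W2]
  have i3: "integrable M (\<lambda>w. ?I w * ((norm (D (Suc n) w))\<^sup>2 - \<sigma> * f (X n w)))"
    by (intro integrable_indicator_mult Bochner_Integration.integrable_diff D_int integrable_mult_right f_X_int) auto
  have i0: "integrable M (\<lambda>w. ?I w * lyapunov (X n w) (V n w))"
    by (intro integrable_indicator_mult lyapunov_int) auto
  have "(\<integral>w. ?I w * lyapunov (X (Suc n) w) (V (Suc n) w) \<partial>M)
    \<le> (\<integral>w. (1 - rate * ?\<gamma>) * (?I w * lyapunov (X n w) (V n w))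
        + ?c1 * (?I w * (g (X n w) \<bullet> D (Suc n) w)) + ?c2 * (?I w * (?W w \<bullet> D (Suc n) w))
        + ?c3 * (?I w * ((norm (D (Suc n) w))\<^sup>2 - \<sigma> * f (X n w))) \<partial>M)"
  proof (rule integral_mono)
    fix w assume w: "w \<in> space M"
    show "?I w * lyapunov (X (Suc n) w) (V (Suc n) w)
      \<le> (1 - rate * ?\<gamma>) * (?I w * lyapunov (X n w) (V n w))
        + ?c1 * (?I w * (g (X n w) \<bullet> D (Suc n) w)) + ?c2 * (?I w * (?W w \<bullet> D (Suc n) w))
        + ?c3 * (?I w * ((norm (D (Suc n) w))\<^sup>2 - \<sigma> * f (X n w)))"
    proof (cases "w \<in> A n")
      case True
      from lyapunov_step[OF \<gamma>_pos \<gamma>_le lojasiewicz[OF A_in_S[OF True]] V_Suc[OF w] X_Suc[OF w]]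
      show ?thesis using True by simp
    qed simp
  qed (use i0 i1 i2 i3 in \<open>auto intro!: integrable_indicator_mult lyapunov_int\<close>)
  also have "\<dots> = (1 - rate * ?\<gamma>) * energy n
      + ?c3 * (\<integral>w. ?I w * ((norm (D (Suc n) w))\<^sup>2 - \<sigma> * f (X n w)) \<partial>M)"
    using i0 i1 i2 i3 by (simp add: energy_def)
  also have "\<dots> \<le> (1 - rate * ?\<gamma>) * energy n"
    using noise_second_moment[of n] noise_const_nonneg[of ?\<gamma>] \<gamma>_pos[of n]
    by (simp add: mult_nonneg_nonpos)
  finally show ?thesis .
qed

lemma energy_nonneg: "0 \<le> energy n"
  unfolding energy_def by (intro integral_nonneg_AE AE_I2 mult_nonneg_nonneg lyapunov_nonneg) simp

lemma energy_Suc: "energy (Suc n) \<le> (1 - rate * \<gamma> (Suc n)) * energy n"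
proof -
  have "energy (Suc n) \<le> (\<integral>w. indicator (A n) w * lyapunov (X (Suc n) w) (V (Suc n) w) \<partial>M)"
    unfolding energy_def
  proof (rule integral_mono)
    fix w
    show "indicat_real (A (Suc n)) w * lyapunov (X (Suc n) w) (V (Suc n) w)
      \<le> indicat_real (A n) w * lyapunov (X (Suc n) w) (V (Suc n) w)"
      using A_Suc[of n] lyapunov_nonneg by (intro mult_right_mono) (auto simp: indicator_def)
  qed (intro integrable_indicator_mult lyapunov_int A_M)+
  then show ?thesis using lyapunov_Suc_le[of n] by linarith
qed

section \<open>Path length and exit probability\<close>

lemma velocity_int: "integrable M (\<lambda>w. indicat_real (A n) w * norm (V k w))"
proof -
  have "integrable M (\<lambda>w. norm (V k w))"
    by (rule square_integrable_imp_integrable) (use V_L2[of k] in \<open>auto simp: square_integrable_def\<close>)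
  then show ?thesis by (intro integrable_indicator_mult) auto
qed

text \<open>Nonnegativity of the variance moves the square inside the integral; then the squared
  velocity is at most twice the Lyapunov function, whose mean over \<open>A n\<close> does not grow
  in the step.\<close>

lemma velocity_le: "(\<integral>w. indicat_real (A n) w * norm (V (Suc n) w) \<partial>M) \<le> sqrt (2 * energy n)"
proof (rule real_le_rsqrt)
  let ?Z = "\<lambda>w. indicat_real (A n) w * norm (V (Suc n) w)"
  have sq: "(?Z w)\<^sup>2 = indicat_real (A n) w * (norm (V (Suc n) w))\<^sup>2" for w
    by (auto simp: indicator_def)
  have Z2: "integrable M (\<lambda>w. (?Z w)\<^sup>2)"
    unfolding sq using V_L2[of "Suc n"] by (intro integrable_indicator_mult) (auto simp: square_integrable_def)
  have "(\<integral>w. ?Z w \<partial>M)\<^sup>2 \<le> (\<integral>w. (?Z w)\<^sup>2 \<partial>M)"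
    using variance_positive[of ?Z] variance_eq[OF velocity_int Z2] by simp
  also have "\<dots> \<le> (\<integral>w. 2 * (indicator (A n) w * lyapunov (X (Suc n) w) (V (Suc n) w)) \<partial>M)"
  proof (rule integral_mono[OF Z2])
    fix w
    have "(norm (V (Suc n) w))\<^sup>2 \<le> 2 * lyapunov (X (Suc n) w) (V (Suc n) w)"
      using lyapunov_lower[of "X (Suc n) w" "V (Suc n) w"] f_nonneg[of "X (Suc n) w"] by linarith
    then show "(?Z w)\<^sup>2 \<le> 2 * (indicator (A n) w * lyapunov (X (Suc n) w) (V (Suc n) w))"
      unfolding sq by (auto simp: indicator_def)
  qed (intro integrable_mult_right integrable_indicator_mult lyapunov_int A_M)
  also have "\<dots> \<le> 2 * ((1 - rate * \<gamma> (Suc n)) * energy n)"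
    using lyapunov_Suc_le[of n] by simp
  also have "\<dots> \<le> 2 * energy n"
    using energy_nonneg[of n] rate_pos \<gamma>_pos[of n] by (simp add: algebra_simps)
  finally show "(\<integral>w. ?Z w \<partial>M)\<^sup>2 \<le> 2 * energy n" .
qed

text \<open>With \<open>p\<close> and \<open>q\<close> the old and new square roots,
  \<open>r * p^2 \<le> (p - q) * (p + q) \<le> 2 * p * (p - q)\<close>; dividing by \<open>p\<close>
  makes the bound telescope without any condition on the sum of the step sizes.\<close>

lemma step_sqrt_energy_le:
  "\<gamma> (Suc n) * sqrt (energy n) \<le> 2 / rate * (sqrt (energy n) - sqrt (energy (Suc n)))"
proof -
  define p q r where "p = sqrt (energy n)" and "q = sqrt (energy (Suc n))" and "r = rate * \<gamma> (Suc n)"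
  have nn: "0 \<le> p" "0 \<le> q" "0 < r"
    using energy_nonneg rate_pos \<gamma>_pos[of n] by (auto simp: p_def q_def r_def)
  have sq: "q\<^sup>2 \<le> p\<^sup>2 - r * p\<^sup>2"
    using energy_Suc[of n] energy_nonneg by (simp add: p_def q_def r_def algebra_simps)
  have "0 \<le> r * p\<^sup>2" using nn by simp
  then have "q\<^sup>2 \<le> p\<^sup>2" using sq by linarith
  then have "q \<le> p" using nn(1) by (rule power2_le_imp_le)
  have "r * p \<le> 2 * (p - q)"
  proof (cases "p = 0")
    case True
    then show ?thesis using \<open>q \<le> p\<close> nn by simp
  next
    case False
    have "p * (r * p) \<le> (p - q) * (p + q)"
      using sq by (simp add: power2_eq_square algebra_simps)
    also have "\<dots> \<le> (p - q) * (2 * p)"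
      using \<open>q \<le> p\<close> by (intro mult_left_mono) auto
    finally have "p * (r * p) \<le> p * (2 * (p - q))" by (simp add: mult_ac)
    then show ?thesis using False nn by simp
  qed
  then show ?thesis
    using rate_pos by (simp add: p_def q_def r_def field_simps)
qed

text \<open>The summand \<open>i\<close> is switched on as long as the path is in \<open>S\<close>
  up to time \<open>i\<close>, so the step that leaves \<open>S\<close> is counted as well.\<close>

definition "path_length n w = (\<Sum>i<n. \<gamma> (Suc i) * (indicat_real (A i) w * norm (V (Suc i) w)))"

lemma path_length_int: "integrable M (path_length n)"
  unfolding path_length_def
  by (intro Bochner_Integration.integrable_sum integrable_mult_right velocity_int)

lemma path_length_nonneg: "0 \<le> path_length n w"
  unfolding path_length_def using \<gamma>_pos by (intro sum_nonneg) (simp add: less_imp_le)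

lemma path_length_mono: "k \<le> n \<Longrightarrow> path_length k w \<le> path_length n w"
  unfolding path_length_def using \<gamma>_pos by (intro sum_mono2) (auto simp: less_imp_le)

lemma integral_path_length: "(\<integral>w. path_length n w \<partial>M) \<le> 4 / rate * sqrt (energy 0)"
proof -
  have "(\<integral>w. path_length n w \<partial>M)
    = (\<Sum>i<n. \<gamma> (Suc i) * (\<integral>w. indicat_real (A i) w * norm (V (Suc i) w) \<partial>M))"
    unfolding path_length_def
    by (subst Bochner_Integration.integral_sum) (auto intro!: velocity_int)
  also have "\<dots> \<le> (\<Sum>i<n. \<gamma> (Suc i) * sqrt (2 * energy i))"
    using \<gamma>_pos velocity_le by (intro sum_mono mult_left_mono) (auto simp: less_imp_le)
  also have "\<dots> = sqrt 2 * (\<Sum>i<n. \<gamma> (Suc i) * sqrt (energy i))"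
    by (simp add: real_sqrt_mult sum_distrib_left mult_ac)
  also have "\<dots> \<le> sqrt 2 * (\<Sum>i<n. 2 / rate * (sqrt (energy i) - sqrt (energy (Suc i))))"
    by (intro mult_left_mono sum_mono step_sqrt_energy_le) auto
  also have "\<dots> = sqrt 2 * (2 / rate * (sqrt (energy 0) - sqrt (energy n)))"
    by (simp only: sum_distrib_left[symmetric] sum_lessThan_telescope'[of "\<lambda>i. sqrt (energy i)"])
  also have "\<dots> \<le> sqrt 2 * (2 / rate * sqrt (energy 0))"
    using rate_pos energy_nonneg by (intro mult_left_mono) auto
  also have "\<dots> \<le> 2 * (2 / rate * sqrt (energy 0))"
    using rate_pos energy_nonneg real_sqrt_le_mono[of 2 4] by (intro mult_right_mono) auto
  finally show ?thesis by simp
qed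

text \<open>At the first exit index the path is outside the ball of radius \<rho>, having started
  within half that radius, and all increments so far were recorded.\<close>

lemma exit_path_length:
  assumes w: "w \<in> space M" and out: "w \<notin> A n"
    and \<rho>: "ball y \<rho> \<subseteq> S" and start: "X 0 w \<in> ball y (\<rho> / 2)"
  shows "\<rho> / 2 \<le> path_length n w"
proof -
  define k where "k = (LEAST i. X i w \<notin> S)"
  obtain j where j: "j \<le> n" "X j w \<notin> S" using w out by (auto simp: stay_event_def)
  have k: "X k w \<notin> S" "k \<le> n"
    using LeastI[of "\<lambda>i. X i w \<notin> S" j] Least_le[of "\<lambda>i. X i w \<notin> S" j] j by (auto simp: k_def)
  have in_S: "X i w \<in> S" if "i < k" for i
    using not_less_Least[of i "\<lambda>i. X i w \<notin> S"] that by (auto simp: k_def)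
  have "norm (X i w - X 0 w) \<le> path_length i w" if "i \<le> k" for i
    using that
  proof (induction i)
    case 0
    then show ?case by (simp add: path_length_def)
  next
    case (Suc i)
    \<comment> \<open>Since \<open>Suc i \<le> k\<close>, the first exit lies after time
      \<open>i\<close>, so the increment of this step is recorded.\<close>
    have "w \<in> A i" using w in_S Suc.prems by (auto simp: stay_event_def)
    then have "path_length (Suc i) w = path_length i w + \<gamma> (Suc i) * norm (V (Suc i) w)"
      by (simp add: path_length_def)
    moreover have "norm (X (Suc i) w - X 0 w) \<le> norm (X i w - X 0 w) + norm (\<gamma> (Suc i) *\<^sub>R V (Suc i) w)"
      using norm_triangle_ineq[of "X i w - X 0 w" "\<gamma> (Suc i) *\<^sub>R V (Suc i) w"]
      by (simp add: X_Suc[OF w] algebra_simps)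
    ultimately show ?case using Suc \<gamma>_pos[of i] by simp
  qed
  then have "norm (X k w - X 0 w) \<le> path_length n w"
    using path_length_mono[OF k(2)] order.trans by blast
  moreover have "\<rho> \<le> dist y (X k w)" using k \<rho> by force
  ultimately show ?thesis
    using start dist_triangle[of y "X k w" "X 0 w"] by (simp add: dist_norm norm_minus_commute)
qed

text \<open>\<open>r \<le> 1\<close> weakens the squared distance bound \<open>r^2\<close> to
  \<open>r\<close>, so that position and velocity both contribute linearly in
  \<open>r\<close>.\<close>

lemma energy_0_le:
  assumes "f y = 0" "0 < r" "r \<le> 1" "AE w in M. X 0 w \<in> ball y r" "(\<integral>w. (norm (V 0 w))\<^sup>2 \<partial>M) \<le> r"
  shows "energy 0 \<le> upper_const * (C + 1) * r"
proof -
  have V0: "integrable M (\<lambda>w. (norm (V 0 w))\<^sup>2)" using V_L2[of 0] by (simp add: square_integrable_def)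
  have "energy 0 \<le> (\<integral>w. upper_const * (C * r + (norm (V 0 w))\<^sup>2) \<partial>M)"
    unfolding energy_def
  proof (rule integral_mono_AE)
    show "integrable M (\<lambda>w. indicat_real (A 0) w * lyapunov (X 0 w) (V 0 w))"
      by (intro integrable_indicator_mult lyapunov_int A_M)
    show "AE w in M. indicat_real (A 0) w * lyapunov (X 0 w) (V 0 w)
      \<le> upper_const * (C * r + (norm (V 0 w))\<^sup>2)"
      using assms(4)
    proof eventually_elim
      case (elim w)
      have "(norm (X 0 w - y))\<^sup>2 \<le> r * 1"
        unfolding power2_eq_square using elim assms(2,3)
        by (intro mult_mono) (auto simp: dist_norm norm_minus_commute)
      then have "f (X 0 w) \<le> C * r"
        using f_le_at_zero[OF assms(1), of "X 0 w"] C_pos mult_left_mono[of "(norm (X 0 w - y))\<^sup>2" r C]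
        by linarith
      then have "upper_const * (f (X 0 w) + (norm (V 0 w))\<^sup>2) \<le> upper_const * (C * r + (norm (V 0 w))\<^sup>2)"
        using upper_const_pos by simp
      moreover have "indicat_real (A 0) w * lyapunov (X 0 w) (V 0 w) \<le> lyapunov (X 0 w) (V 0 w)"
        using lyapunov_nonneg by (auto simp: indicator_def)
      ultimately show ?case using lyapunov_upper[of "X 0 w" "V 0 w"] by linarith
    qed
  qed (use V0 in simp)
  also have "\<dots> = upper_const * (C * r + (\<integral>w. (norm (V 0 w))\<^sup>2 \<partial>M))"
    using V0 by (simp add: prob_space)
  also have "\<dots> \<le> upper_const * (C * r + r)"
    using assms(5) upper_const_pos by simp
  finally show ?thesis by (simp add: algebra_simps)
qed

text \<open>Markov's inequality for the path length bounds the probability of exit by time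
  \<open>n\<close> uniformly in \<open>n\<close>; continuity from above along the decreasing events
  \<open>A n\<close> gives the limit.\<close>

lemma exit_probability:
  assumes "0 < \<rho>" "ball y \<rho> \<subseteq> S" "AE w in M. X 0 w \<in> ball y (\<rho> / 2)"
  shows "prob (space M - (\<Inter>n. A n)) \<le> 8 / (rate * \<rho>) * sqrt (energy 0)"
proof -
  let ?b = "8 / (rate * \<rho>) * sqrt (energy 0)"
  have "prob (space M - A n) \<le> ?b" for n
  proof -
    have "prob (space M - A n) \<le> prob {w \<in> space M. \<rho> / 2 \<le> path_length n w}"
    proof (rule finite_measure_mono_AE)
      show "AE w in M. w \<in> space M - A n \<longrightarrow> w \<in> {w \<in> space M. \<rho> / 2 \<le> path_length n w}"
        using assms(3) by eventually_elim (use exit_path_length[OF _ _ assms(2)] in auto)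
      show "{w \<in> space M. \<rho> / 2 \<le> path_length n w} \<in> sets M"
        using borel_measurable_integrable[OF path_length_int] by measurable
    qed
    also have "\<dots> \<le> (\<integral>w. path_length n w \<partial>M) / (\<rho> / 2)"
      using assms(1) path_length_nonneg path_length_int
      by (intro integral_Markov_inequality_measure[where A = "{}"]) auto
    also have "\<dots> \<le> (4 / rate * sqrt (energy 0)) / (\<rho> / 2)"
      using assms(1) integral_path_length by (intro divide_right_mono) auto
    finally show ?thesis by (simp add: mult_ac)
  qed
  then have "1 - ?b \<le> prob (A n)" for n
    using prob_compl[OF A_M[of n]] by (smt (verit))
  moreover have "(\<lambda>n. prob (A n)) \<longlonglongrightarrow> prob (\<Inter>n. A n)"
    using A_Suc by (intro finite_Lim_measure_decseq decseq_SucI) auto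
  ultimately have "1 - ?b \<le> prob (\<Inter>n. A n)"
    by (intro LIMSEQ_le_const) auto
  moreover have "(\<Inter>n. A n) \<in> sets M" by (intro sets.countable_INT) auto
  ultimately show ?thesis using prob_compl[of "\<Inter>n. A n"] by simp
qed

end

section \<open>Choice of the constants and conclusion\<close>

theorem corollary3p3:
  fixes f :: "real ^ 'd \<Rightarrow> real" and gradf :: "real ^ 'd \<Rightarrow> real ^ 'd"
    and C\<^sub>L \<mu> L \<sigma> :: real and S :: "(real ^ 'd) set" and y :: "real ^ 'd"
  assumes "\<And>x. GDERIV f x :> gradf x"
    and "C\<^sub>L-lipschitz_on UNIV gradf"
    and "bdd_below (range f)" and "(INF x. f x) = 0"
    and "\<mu> > 0" and "L > 0" and "\<sigma> \<ge> 0"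
    and "open S"
    and "\<And>x. x \<in> S \<Longrightarrow> (norm (gradf x))\<^sup>2 \<ge> 2 * L * f x"
    and "y \<in> S" and "f y = 0"
  shows "\<exists>\<gamma>bar>0. \<forall>\<gamma> :: nat \<Rightarrow> real.
    (\<forall>n\<ge>1. \<gamma> n > 0) \<longrightarrow> (SUP n\<in>{1..}. ereal (\<gamma> n)) \<le> ereal \<gamma>bar \<longrightarrow>
    (\<forall>\<epsilon>>0. \<exists>r\<^sub>0>0. \<forall>(M :: 'w measure) F D X V.
       msgd M F gradf \<mu> \<gamma> D X V \<longrightarrow>
       (\<forall>n. AE w in M. w \<in> stay_event M X S n \<longrightarrow>
          real_cond_exp M (F n) (\<lambda>v. (norm (D (Suc n) v))\<^sup>2) w \<le> \<sigma> * f (X n w)) \<longrightarrow>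
       (AE w in M. X 0 w \<in> ball y r\<^sub>0) \<longrightarrow>
       (\<integral>w. (norm (V 0 w))\<^sup>2 \<partial>M) \<le> r\<^sub>0 \<longrightarrow>
       measure M (space M - (\<Inter>n. stay_event M X S n)) \<le> \<epsilon>)"
proof -
  \<comment> \<open>The Lipschitz constant may be 0, whereas the estimates divide by
    \<open>C\<close>.\<close>
  define C where "C = C\<^sub>L + 1"
  have C: "0 \<le> C\<^sub>L" "0 < C" using assms(2) by (auto simp: C_def lipschitz_on_def)
  have lip: "norm (gradf u - gradf v) \<le> C * norm (u - v)" for u v
    using lipschitz_onD[OF assms(2), of u v] mult_right_mono[of C\<^sub>L C "norm (u - v)"]
    by (auto simp: C_def dist_norm)
  have nonneg: "0 \<le> f x" for x
    using cINF_lower[OF assms(3), of x] assms(4) by simp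
  interpret P: momentum_descent f gradf C \<mu> L \<sigma>
    using assms C lip nonneg by unfold_locales auto
  obtain \<rho> where \<rho>: "0 < \<rho>" "ball y \<rho> \<subseteq> S"
    using assms(8,10) open_contains_ball by blast
  show ?thesis
  \<comment> \<open>This witness depends only on \<open>C\<close>, \<mu>, \<open>L\<close> and
    \<sigma>, so it precedes the choice of \<gamma> and \<epsilon>.\<close>
  proof (rule exI[of _ P.step_bound], intro conjI allI impI P.step_bound_pos)
    fix \<gamma> :: "nat \<Rightarrow> real" and \<epsilon> :: real
    assume pos: "\<forall>n\<ge>1. \<gamma> n > 0" and sup: "(SUP n\<in>{1..}. ereal (\<gamma> n)) \<le> ereal P.step_bound"
      and \<epsilon>: "0 < \<epsilon>"
    have le: "\<gamma> n \<le> P.step_bound" if "n \<ge> 1" for n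
      using sup that by (auto simp: SUP_le_iff)
    define K where "K = P.upper_const * (C + 1)"
    \<comment> \<open>The first two entries serve \<open>energy_0_le\<close> and the start in the
      half ball; the third solves \<open>8 / (rate * \<rho>) * sqrt (K * r) \<le> \<epsilon>\<close>
      for \<open>r\<close>.\<close>
    define r where "r = min (min 1 (\<rho> / 2)) ((\<epsilon> * P.rate * \<rho> / 8)\<^sup>2 / K)"
    have K: "0 < K" using C P.upper_const_pos by (simp add: K_def)
    have r: "0 < r" "r \<le> 1" "r \<le> \<rho> / 2" "K * r \<le> (\<epsilon> * P.rate * \<rho> / 8)\<^sup>2"
    proof -
      have "K * r \<le> K * ((\<epsilon> * P.rate * \<rho> / 8)\<^sup>2 / K)"
        using K by (intro mult_left_mono) (auto simp: r_def)
      then show "K * r \<le> (\<epsilon> * P.rate * \<rho> / 8)\<^sup>2" using K by simp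
      show "r \<le> \<rho> / 2" unfolding r_def by linarith
    qed (use \<epsilon> \<rho> K P.rate_pos in \<open>auto simp: r_def\<close>)
    show "\<exists>r\<^sub>0>0. \<forall>(M :: 'w measure) F D X V.
       msgd M F gradf \<mu> \<gamma> D X V \<longrightarrow>
       (\<forall>n. AE w in M. w \<in> stay_event M X S n \<longrightarrow>
          real_cond_exp M (F n) (\<lambda>v. (norm (D (Suc n) v))\<^sup>2) w \<le> \<sigma> * f (X n w)) \<longrightarrow>
       (AE w in M. X 0 w \<in> ball y r\<^sub>0) \<longrightarrow>
       (\<integral>w. (norm (V 0 w))\<^sup>2 \<partial>M) \<le> r\<^sub>0 \<longrightarrow>
       measure M (space M - (\<Inter>n. stay_event M X S n)) \<le> \<epsilon>"
    proof (intro exI[of _ r] conjI allI impI r(1))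
      fix M :: "'w measure" and F D X V
      assume M: "msgd M F gradf \<mu> \<gamma> D X V"
        "\<forall>n. AE w in M. w \<in> stay_event M X S n \<longrightarrow>
          real_cond_exp M (F n) (\<lambda>v. (norm (D (Suc n) v))\<^sup>2) w \<le> \<sigma> * f (X n w)"
        and start: "AE w in M. X 0 w \<in> ball y r" "(\<integral>w. (norm (V 0 w))\<^sup>2 \<partial>M) \<le> r"
      interpret Q: momentum_process f gradf C \<mu> L \<sigma> M F \<gamma> D X V S
        using M assms pos le by unfold_locales auto
      have "sqrt (Q.energy 0) \<le> \<epsilon> * P.rate * \<rho> / 8"
        using Q.energy_0_le[OF assms(11) r(1,2) start] r(4) \<epsilon> \<rho> P.rate_pos
        by (intro real_le_lsqrt) (auto simp: K_def)
      then have "8 / (P.rate * \<rho>) * sqrt (Q.energy 0) \<le> 8 / (P.rate * \<rho>) * (\<epsilon> * P.rate * \<rho> / 8)"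
        using \<rho> P.rate_pos by (intro mult_left_mono) auto
      also have "\<dots> = \<epsilon>" using \<rho> P.rate_pos by simp
      finally have b: "8 / (P.rate * \<rho>) * sqrt (Q.energy 0) \<le> \<epsilon>" .
      have "AE w in M. X 0 w \<in> ball y (\<rho> / 2)"
        using start(1) by eventually_elim (use r(3) in auto)
      from Q.exit_probability[OF \<rho> this] b
      show "measure M (space M - (\<Inter>n. stay_event M X S n)) \<le> \<epsilon>" by linarith
    qed
  qed
qed

end
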